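(* Among all residue classes modulo $4$, the class $k\equiv 2\pmod 4$ with $k\ge 6$ is the unique class where every position in $\mathcal{L}_1$ is algebraically obstructed.
   Context: The principal skeleton is $\mathcal{L}_1=\{2^a\cdot 3^b-1: a\ge 1,\ b\ge 0\}$ with $a,b$ integers; the position $(a,b)$ holds the element $2^a\cdot 3^b-1$ and lies in row $k=a+b$. Residue classes modulo $4$ are classes of the row index $k$, and the positions belonging to a class are those lying in rows $k$ of that class. The difference-of-squares obstruction applies to the position $(a,b)$ when $a$ and $b$ are both even. The divisibility-by-$5$ obstruction applies to the position $(a,b)$ when $a$ and $b$ are both odd with $a\equiv b\pmod 4$. A position is algebraically obstructed if it is covered by at least one of these two obstructions. *)

theory Defs
  imports "HOL-Number_Theory.Cong"
begin

definition position_element :: "nat \<times> nat \<Rightarrow> nat" where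
  "position_element = (\<lambda>(a, b). 2 ^ a * 3 ^ b - 1)"

definition positions :: "(nat \<times> nat) set" where
  "positions = {(a, b). a \<ge> 1}"

definition principal_skeleton :: "nat set" where
  "principal_skeleton = position_element ` positions"

definition row :: "nat \<times> nat \<Rightarrow> nat" where
  "row = (\<lambda>(a, b). a + b)"

definition positions_of_class :: "nat \<Rightarrow> (nat \<times> nat) set" where
  "positions_of_class r = {p \<in> positions. [row p = r] (mod 4)}"

text \<open>The two obstructions are conditions on the exponents only. The lemmas below record the
  factor of the element at the position that each of them produces. That factor may be trivial in
  row 2: the elements at the positions (2, 0) and (1, 1) are the primes 3 and 5, even though both
  positions satisfy the exponent conditions.\<close>

definition diff_squares_obstruction :: "nat \<times> nat \<Rightarrow> bool" where
  "diff_squares_obstruction = (\<lambda>(a, b). even a \<and> even b)"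

definition div5_obstruction :: "nat \<times> nat \<Rightarrow> bool" where
  "div5_obstruction = (\<lambda>(a, b). odd a \<and> odd b \<and> [a = b] (mod 4))"

definition algebraically_obstructed :: "nat \<times> nat \<Rightarrow> bool" where
  "algebraically_obstructed p \<longleftrightarrow> diff_squares_obstruction p \<or> div5_obstruction p"

lemma diff_squares_obstruction_factorization:
  assumes "diff_squares_obstruction (a, b)"
  shows "position_element (a, b) =
    (2 ^ (a div 2) * 3 ^ (b div 2) - 1) * (2 ^ (a div 2) * 3 ^ (b div 2) + 1)"
proof -
  from assms obtain c d where cd: "a = 2 * c" "b = 2 * d"
    by (auto simp: diff_squares_obstruction_def elim!: evenE)
  define x :: nat where "x = 2 ^ c * 3 ^ d"
  have "(2::nat) ^ a * 3 ^ b = x * x"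
    by (simp add: cd x_def power_mult_distrib power_mult[symmetric] mult.commute[of 2]
        power_mult power2_eq_square)
  moreover have "x * x - 1 = (x - 1) * (x + 1)"
    by (cases x) auto
  ultimately show ?thesis
    by (simp add: position_element_def cd x_def)
qed

lemma div5_obstruction_dvd:
  assumes "div5_obstruction (a, b)"
  shows "5 dvd position_element (a, b)"
proof -
  have period: "(3::nat) ^ n mod 5 = 3 ^ (n mod 4) mod 5" for n
  proof -
    have "(3::nat) ^ n = (3 ^ 4) ^ (n div 4) * 3 ^ (n mod 4)"
      by (metis mult_div_mod_eq power_add power_mult)
    moreover have "((3::nat) ^ 4) ^ (n div 4) mod 5 = 1"
      by (subst power_mod[symmetric]) simp
    ultimately show ?thesis
      by (metis mod_mult_left_eq mult_1)
  qed
  have "(3::nat) ^ b mod 5 = 3 ^ a mod 5"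
    using assms period[of a] period[of b] by (simp add: div5_obstruction_def cong_def)
  then have "(2::nat) ^ a * 3 ^ b mod 5 = 2 ^ a * 3 ^ a mod 5"
    by (metis mod_mult_right_eq)
  also have "\<dots> = 6 ^ a mod 5"
    by (simp flip: power_mult_distrib)
  also have "\<dots> = 1"
    by (subst power_mod[symmetric]) simp
  finally show ?thesis
    unfolding position_element_def by (metis case_prod_conv dvd_minus_mod)
qed

end

theory Submission
  imports Defs
begin

text \<open>When the exponents \<open>a\<close> and \<open>b\<close> are odd, \<open>2 * a\<close> is \<open>2\<close> modulo \<open>4\<close>, so \<open>a\<close> and \<open>b\<close> agree
  modulo \<open>4\<close> exactly when \<open>a + b\<close> is \<open>2\<close> modulo \<open>4\<close>. Hence the second obstruction is a condition on
  the row together with the parity (\<open>algebraically_obstructed_iff\<close>). A row that is \<open>2\<close> modulo \<open>4\<close> has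
  exponents of equal parity, and the two obstructions take the two parities. Any other row loses its
  positions with odd \<open>a\<close>: the difference of squares never reaches them, and divisibility by \<open>5\<close>
  requires the row to be \<open>2\<close> modulo \<open>4\<close>.\<close>

text \<open>Stating both obstructions through parity and the row makes the dependence on the residue
  class of the row visible.\<close>

lemma algebraically_obstructed_iff:
  "algebraically_obstructed (a, b) \<longleftrightarrow>
     even a \<and> even b \<or> odd a \<and> odd b \<and> [row (a, b) = 2] (mod 4)"
proof -
  have "[a = b] (mod 4) \<longleftrightarrow> [a + b = 2] (mod 4)" if "odd a" "odd b"
  proof -
    obtain c where "a = 2 * c + 1"
      using \<open>odd a\<close> by (elim oddE)
    then have "[a + a = 2] (mod 4)"
      unfolding cong_def by presburger
    moreover have "[a = b] (mod 4) \<longleftrightarrow> [a + a = a + b] (mod 4)"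
      by (simp only: cong_add_lcancel_nat)
    ultimately show ?thesis
      by (meson cong_sym cong_trans)
  qed
  then show ?thesis
    by (auto simp: algebraically_obstructed_def diff_squares_obstruction_def
        div5_obstruction_def row_def)
qed

lemma algebraically_obstructed_if_row_cong_2:
  assumes "[row p = 2] (mod 4)"
  shows "algebraically_obstructed p"
proof (cases p)
  case (Pair a b)
  have "even (row p)"
    using assms unfolding cong_def by presburger
  then have "even a \<longleftrightarrow> even b"
    by (simp add: Pair row_def)
  then show ?thesis
    using assms by (auto simp: Pair algebraically_obstructed_iff)
qed

text \<open>An odd first exponent disables the difference of squares, and every row from \<open>7\<close> on contains
  a position with first exponent \<open>7\<close>.\<close>

lemma not_algebraically_obstructed_if_odd:
  assumes "odd a" and "\<not> [row (a, b) = 2] (mod 4)"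
  shows "\<not> algebraically_obstructed (a, b)"
  using assms by (simp add: algebraically_obstructed_iff)

theorem corollary4p3:
  "\<forall>r \<in> {0..<4::nat}.
     (\<forall>p \<in> positions_of_class r. row p \<ge> 6 \<longrightarrow> algebraically_obstructed p) \<longleftrightarrow> r = 2"
proof (rule ballI, rule iffI)
  fix r :: nat
  assume r: "r \<in> {0..<4}"
    and obstructed: "\<forall>p \<in> positions_of_class r. row p \<ge> 6 \<longrightarrow> algebraically_obstructed p"
  \<comment> \<open>First exponent \<open>7\<close> is odd and at least \<open>6\<close>; the second exponent \<open>r + 1\<close> gives the row residue \<open>r\<close>.\<close>
  have row: "row (7, r + 1) = r + 2 * 4"
    by (simp add: row_def)
  then have cong: "[row (7, r + 1) = r] (mod 4)"
    by (simp only: cong_def mod_mult_self1)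
  then have "(7, r + 1) \<in> positions_of_class r" "row (7, r + 1) \<ge> 6"
    using row by (simp_all add: positions_of_class_def positions_def)
  then have "algebraically_obstructed (7, r + 1)"
    using obstructed by blast
  then have "[row (7, r + 1) = 2] (mod 4)"
    using not_algebraically_obstructed_if_odd[of 7 "r + 1"] by auto
  then have "[r = 2] (mod 4)"
    using cong by (meson cong_sym cong_trans)
  then show "r = 2"
    using r by (simp add: cong_def)
next
  fix r :: nat
  assume "r = 2"
  then show "\<forall>p \<in> positions_of_class r. row p \<ge> 6 \<longrightarrow> algebraically_obstructed p"
    by (auto simp: positions_of_class_def intro: algebraically_obstructed_if_row_cong_2)
qed

end
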